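(* Let $N$ be a univariate Hawkes process on $(0,\infty)$ with baseline intensity $\lambda_0>0$ and exponential kernel $h(t)=\alpha \mathrm{e}^{-\beta t}$, where $\alpha\in\mathbb{R}$ and $\beta>0$. Let $T_1<T_2<\cdots$ be its event times, $\lambda^\star$ its underlying intensity function, $(T_k^\star)_{k\ge1}$ its restart times and $\Lambda$ its compensator. Let $t>0$ and $k\in\{1,\dots,N(t)\}$. Then the restart times read $$ T_k^\star=T_k+\beta^{-1}\log\!\left(\frac{\lambda_0-\lambda^\star(T_k)}{\lambda_0}\right)\mathbf{1}_{\lambda^\star(T_k)<0} $$ (the second term being $0$ when $\lambda^\star(T_k)\ge 0$), and the compensator is expressed as $$ \Lambda(t)= \begin{cases} \lambda_0 t & \text{if } t<T_1,\\[4pt] \displaystyle \lambda_0 T_1+\sum_{j=1}^{N(t)-1}\int_{T_j^\star}^{T_{j+1}}\lambda^\star(u)\,\mathrm{d}u+\int_{T_{N(t)}^\star}^{t}\lambda^\star(u)\,\mathrm{d}u & \text{if } t\ge T_1 \end{cases} $$ (with the conventions that the sum is $0$ if $N(t)=1$ and the last integral is $0$ if $t<T_{N(t)}^\star$), where, for any $\tau\in[T_k^\star,T_{k+1}]$, $$ \int_{T_k^\star}^{\tau}\lambda^\star(u)\,\mathrm{d}u=\lambda_0(\tau-T_k^\star)+\beta^{-1}\big(\lambda^\star(T_k)-\lambda_0\big)\Big(\mathrm{e}^{-\beta(T_k^\star-T_k)}-\mathrm{e}^{-\beta(\tau-T_k)}\Big). $$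
   Context: $N$ is a (simple) point process on $(0,\infty)$ with event times $0<T_1<T_2<\cdots$ (convention $T_0=0$), and $N(t)=\sum_{k\ge1}\mathbf{1}_{T_k\le t}$ is the number of events in $[0,t]$. For real $x$, $x^+=\max(0,x)$. $N$ is a univariate Hawkes process with baseline $\lambda_0>0$ and kernel $h:[0,\infty)\to\mathbb{R}$ if its conditional intensity is $$\lambda(t)=\Big(\lambda_0+\int_0^t h(t-s)\,\mathrm{d}N(s)\Big)^+=\Big(\lambda_0+\sum_{T_k\le t}h(t-T_k)\Big)^+ .$$ The compensator is $\Lambda(t)=\int_0^t\lambda(u)\,\mathrm{d}u$. The underlying intensity function is $\lambda^\star(t)=\lambda_0+\int_0^t h(t-s)\,\mathrm{d}N(s)=\lambda_0+\sum_{T_k\le t}h(t-T_k)$; for the exponential kernel, $\lambda^\star(t)=\lambda_0+\sum_{T_k\le t}\alpha \mathrm{e}^{-\beta(t-T_k)}$ (in particular $\lambda^\star(T_k)$ includes the contribution $\alpha$ of the event at $T_k$). For $k\ge1$, the restart time is $T_k^\star=\inf\{t\ge T_k : \lambda(t)>0\}$. Identities between random quantities are understood almost surely; in particular, since $\lambda$ is the conditional intensity of $N$, almost surely every event time satisfies $\lambda(T_k^-)>0$, where $\lambda(T_k^-)=\lim_{s\uparrow T_k}\lambda(s)$. *)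

theory Defs
  imports "HOL-Probability.Probability"
begin

text \<open>
  A simple point process on \<open>(0,\<infinity>)\<close> is given by its event times
  \<open>0 = T\<^sub>0 < T\<^sub>1 < T\<^sub>2 < \<dots>\<close>; index \<open>0\<close> is only a convention and is not an event.
  The last assumption is local finiteness: finitely many events in bounded time.
\<close>
locale simple_point_process = prob_space M for M :: "'w measure" +
  fixes T :: "nat \<Rightarrow> 'w \<Rightarrow> real"
  assumes T_measurable: "\<And>k. T k \<in> borel_measurable M"
    and T_0: "\<And>\<omega>. \<omega> \<in> space M \<Longrightarrow> T 0 \<omega> = 0"
    and T_strict_mono: "\<And>\<omega>. \<omega> \<in> space M \<Longrightarrow> strict_mono (\<lambda>k. T k \<omega>)"
    and T_locally_finite: "\<And>\<omega> t. \<omega> \<in> space M \<Longrightarrow> finite {k. T k \<omega> \<le> t}"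

definition events_upto :: "(nat \<Rightarrow> 'w \<Rightarrow> real) \<Rightarrow> real \<Rightarrow> 'w \<Rightarrow> nat set" where
  "events_upto T t \<omega> = {k. 1 \<le> k \<and> T k \<omega> \<le> t}"

definition counting :: "(nat \<Rightarrow> 'w \<Rightarrow> real) \<Rightarrow> real \<Rightarrow> 'w \<Rightarrow> nat" where
  "counting T t \<omega> = card (events_upto T t \<omega>)"

definition history :: "'w measure \<Rightarrow> (nat \<Rightarrow> 'w \<Rightarrow> real) \<Rightarrow> real \<Rightarrow> 'w measure" where
  "history M T t =
     sigma (space M) {counting T s -` {n} \<inter> space M | s n. 0 \<le> s \<and> s \<le> t}"

definition predictable :: "'w measure \<Rightarrow> (nat \<Rightarrow> 'w \<Rightarrow> real) \<Rightarrow> (real \<times> 'w) measure" where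
  "predictable M T =
     sigma ({0<..} \<times> space M)
       {{s<..u} \<times> A | s u A. 0 \<le> s \<and> s \<le> u \<and> A \<in> sets (history M T s)}"

text \<open>
  Conditional intensity with respect to the natural history of the process, in the sense of
  Bremaud (Point Processes and Queues, 1981): \<open>l\<close> is a nonnegative, progressively measurable,
  almost surely locally integrable process such that
  \<open>E (\<integral> C dN) = E (\<integral> C(t) l(t) dt)\<close> for every nonnegative predictable process \<open>C\<close>.
  On the left, the integral against \<open>dN\<close> is the sum of \<open>C\<close> over all event times \<open>T\<^sub>1, T\<^sub>2, \<dots>\<close>.
\<close>
definition conditional_intensity ::
    "'w measure \<Rightarrow> (nat \<Rightarrow> 'w \<Rightarrow> real) \<Rightarrow> (real \<Rightarrow> 'w \<Rightarrow> real) \<Rightarrow> bool" where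
  "conditional_intensity M T l \<longleftrightarrow>
     (\<forall>t\<ge>0. \<forall>\<omega>\<in>space M. 0 \<le> l t \<omega>) \<and>
     (\<forall>t\<ge>0. (\<lambda>(s, \<omega>). l s \<omega>)
        \<in> borel_measurable (restrict_space borel {0..t} \<Otimes>\<^sub>M history M T t)) \<and>
     (AE \<omega> in M. \<forall>t\<ge>0. set_integrable lborel {0..t} (\<lambda>u. l u \<omega>)) \<and>
     (\<forall>C \<in> measurable (predictable M T) (borel :: ennreal measure).
        (\<integral>\<^sup>+\<omega>. (\<Sum>k. C (T (Suc k) \<omega>, \<omega>)) \<partial>M) =
        (\<integral>\<^sup>+\<omega>. (\<integral>\<^sup>+u\<in>{0<..}. (C (u, \<omega>) * ennreal (l u \<omega>)) \<partial>lborel) \<partial>M))"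

definition underlying_intensity ::
    "real \<Rightarrow> (real \<Rightarrow> real) \<Rightarrow> (nat \<Rightarrow> 'w \<Rightarrow> real) \<Rightarrow> real \<Rightarrow> 'w \<Rightarrow> real" where
  "underlying_intensity lambda0 h T t \<omega> =
     lambda0 + (\<Sum>k\<in>events_upto T t \<omega>. h (t - T k \<omega>))"

definition intensity ::
    "real \<Rightarrow> (real \<Rightarrow> real) \<Rightarrow> (nat \<Rightarrow> 'w \<Rightarrow> real) \<Rightarrow> real \<Rightarrow> 'w \<Rightarrow> real" where
  "intensity lambda0 h T t \<omega> = max 0 (underlying_intensity lambda0 h T t \<omega>)"

text \<open>Only the values of the kernel \<open>h\<close> on \<open>[0,\<infinity>)\<close> matter.\<close>
locale hawkes_process = simple_point_process M T
  for M :: "'w measure" and T :: "nat \<Rightarrow> 'w \<Rightarrow> real" +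
  fixes lambda0 :: real and h :: "real \<Rightarrow> real"
  assumes baseline_pos: "0 < lambda0"
    and intensity: "conditional_intensity M T (intensity lambda0 h T)"

definition compensator ::
    "real \<Rightarrow> (real \<Rightarrow> real) \<Rightarrow> (nat \<Rightarrow> 'w \<Rightarrow> real) \<Rightarrow> real \<Rightarrow> 'w \<Rightarrow> real" where
  "compensator lambda0 h T t \<omega> = (LBINT u=0..t. intensity lambda0 h T u \<omega>)"

text \<open>
  The infimum is taken in the reals.  The set is bounded below, and for a Hawkes process it is
  almost surely nonempty, because the intensity is positive just before the next event.
\<close>
definition restart_time ::
    "real \<Rightarrow> (real \<Rightarrow> real) \<Rightarrow> (nat \<Rightarrow> 'w \<Rightarrow> real) \<Rightarrow> nat \<Rightarrow> 'w \<Rightarrow> real" where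
  "restart_time lambda0 h T k \<omega> = Inf {t. T k \<omega> \<le> t \<and> 0 < intensity lambda0 h T t \<omega>}"

end

theory Submission
  imports Defs
begin

text \<open>
  Between two consecutive events the underlying intensity of an exponential Hawkes process is
  deterministic: on \<open>[T\<^sub>n, T\<^sub>n\<^sub>+\<^sub>1)\<close> it is the solution
  \<open>\<lambda>\<^sub>0 + (\<lambda>\<^sup>\<star>(T\<^sub>n) - \<lambda>\<^sub>0) exp (- \<beta> (t - T\<^sub>n))\<close> of a linear equation that relaxes
  monotonically towards \<open>\<lambda>\<^sub>0 > 0\<close>.  If it starts at a negative value, it changes sign exactly once, at
  the explicit time that the proposition gives; if it starts at a nonnegative value, it is positive
  immediately afterwards.  So this zero crossing is the restart time, and the compensator collects
  only the part of each inter-event interval after the crossing, provided that the crossing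
  takes place before the next event.

  That proviso is the only probabilistic point.  It says that almost surely every event time has a
  positive left-limit intensity (\<open>AE_intensity_pos_before_event\<close>).  To see this, test the
  defining identity of the conditional intensity with the indicator \<open>C\<close> of the set where the left
  limit of the intensity vanishes.  The integral of \<open>C \<lambda>\<close> over time is zero, because the intensity
  equals its left limit outside the countable set of event times.  Hence the expected number of
  events in the set is zero as well.  The test process is predictable because a left limit is the
  limit of samples of an adapted process at grid points strictly before the current time
  (\<open>grid_sampled_predictable\<close>).  Positivity of the left limit at the next event then forces the
  zero crossing to come strictly earlier (\<open>zero_crossing_less\<close>), which excludes the boundary case where
  the crossing would coincide with the event and an inhibiting jump would postpone the restart.

  The rest is pathwise: the integral after a restart is an instance of the fundamental theorem of
  calculus, and the compensator formula follows by additivity of the integral over the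
  inter-event intervals.
\<close>

section \<open>Event paths\<close>

text \<open>
  The underlying intensity with the event count held at \<open>n\<close>.  Unlike the underlying intensity itself
  it does not jump at \<open>T\<^sub>n\<^sub>+\<^sub>1\<close>, so for a kernel continuous on \<open>(0, \<infinity>)\<close> its
  value there is the left limit of the underlying intensity.
\<close>
definition branch :: "real \<Rightarrow> (real \<Rightarrow> real) \<Rightarrow> (nat \<Rightarrow> 'w \<Rightarrow> real) \<Rightarrow> nat \<Rightarrow> real \<Rightarrow> 'w \<Rightarrow> real" where
  "branch lambda0 h T n t \<omega> = lambda0 + (\<Sum>k\<in>{1..n}. h (t - T k \<omega>))"

text \<open>
  A single outcome is held fixed here, so that almost sure statements reduce to statements about one
  sequence of event times.
\<close>
locale event_path =
  fixes T :: "nat \<Rightarrow> 'w \<Rightarrow> real" and \<omega> :: 'w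
  assumes start: "T 0 \<omega> = 0"
    and mono: "strict_mono (\<lambda>k. T k \<omega>)"
    and locally_finite: "\<And>t. finite {k. T k \<omega> \<le> t}"
begin

lemma less_iff: "T i \<omega> < T j \<omega> \<longleftrightarrow> i < j"
  using strict_mono_less[OF mono] by simp

lemma le_iff: "T i \<omega> \<le> T j \<omega> \<longleftrightarrow> i \<le> j"
  using strict_mono_less_eq[OF mono] by simp

lemma event_nonneg: "0 \<le> T n \<omega>"
  using le_iff[of 0 n] start by simp

lemma event_le_iff:
  assumes "T n \<omega> \<le> t" "t < T (Suc n) \<omega>"
  shows "T k \<omega> \<le> t \<longleftrightarrow> k \<le> n"
proof
  assume "T k \<omega> \<le> t"
  then have "T k \<omega> < T (Suc n) \<omega>" using assms by simp
  then show "k \<le> n" by (simp add: less_iff)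
next
  assume "k \<le> n"
  then show "T k \<omega> \<le> t" using assms le_iff[of k n] by simp
qed

lemma events_upto_between:
  assumes "T n \<omega> \<le> t" "t < T (Suc n) \<omega>"
  shows "events_upto T t \<omega> = {1..n}"
  by (simp add: events_upto_def event_le_iff[OF assms] set_eq_iff)

lemma counting_between:
  assumes "T n \<omega> \<le> t" "t < T (Suc n) \<omega>"
  shows "counting T t \<omega> = n"
  by (simp add: counting_def events_upto_between[OF assms])

lemma underlying_between:
  assumes "T n \<omega> \<le> t" "t < T (Suc n) \<omega>"
  shows "underlying_intensity l h T t \<omega> = branch l h T n t \<omega>"
  by (simp add: underlying_intensity_def branch_def events_upto_between[OF assms])

lemma intensity_between:
  assumes "T n \<omega> \<le> t" "t < T (Suc n) \<omega>"
  shows "intensity l h T t \<omega> = max 0 (branch l h T n t \<omega>)"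
  by (simp add: intensity_def underlying_between[OF assms])

lemma last_event_exists:
  assumes "0 \<le> t"
  obtains n where "T n \<omega> \<le> t" "t < T (Suc n) \<omega>"
proof -
  let ?n = "Max {k. T k \<omega> \<le> t}"
  have "0 \<in> {k. T k \<omega> \<le> t}" using assms start by simp
  then have "T ?n \<omega> \<le> t" using Max_in[OF locally_finite[of t]] by blast
  moreover have "\<not> T (Suc ?n) \<omega> \<le> t"
    using Max_ge[OF locally_finite[of t], of "Suc ?n"] by auto
  ultimately show thesis using that by (simp add: not_le)
qed

text \<open>
  The half-open interval has its closed end on the right, as is needed for left limits: at an event
  time \<open>t = T\<^sub>n\<^sub>+\<^sub>1\<close> the left limit is governed by the first \<open>n\<close> events only.
\<close>
lemma last_event_before_exists:
  assumes "0 < t"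
  obtains n where "T n \<omega> < t" "t \<le> T (Suc n) \<omega>"
proof -
  obtain n where n: "T n \<omega> \<le> t" "t < T (Suc n) \<omega>"
    using last_event_exists[of t] assms by auto
  show thesis
  proof (cases "T n \<omega> = t")
    case True
    then obtain m where "n = Suc m" using assms start by (cases n) auto
    then show thesis using that[of m] True less_iff[of m n] by simp
  next
    case False
    then show thesis using that[of n] n by simp
  qed
qed

end

section \<open>Left limits as predictable processes\<close>

text \<open>
  The last point of the lattice \<open>{j / (m + 1)}\<close> strictly before \<open>t\<close>.  Strictness is what makes samples
  at this point predictable and gives the left limit, not the value, as \<open>m\<close> grows.
\<close>
definition grid :: "nat \<Rightarrow> real \<Rightarrow> real" where
  "grid m t = (of_int \<lceil>t * real (Suc m)\<rceil> - 1) / real (Suc m)"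

lemma grid_less: "grid m t < t"
proof -
  have "of_int \<lceil>t * real (Suc m)\<rceil> - 1 < t * real (Suc m)" by linarith
  then show ?thesis unfolding grid_def by (simp add: pos_divide_less_eq del: of_nat_Suc)
qed

lemma grid_ge: "t - 1 / real (Suc m) \<le> grid m t"
proof -
  have "t - 1 / real (Suc m) = (t * real (Suc m) - 1) / real (Suc m)"
    by (simp add: diff_divide_distrib del: of_nat_Suc)
  also have "\<dots> \<le> grid m t" unfolding grid_def
    by (intro divide_right_mono) (auto simp del: of_nat_Suc)
  finally show ?thesis .
qed

lemma grid_tendsto: "(\<lambda>m. grid m t) \<longlonglongrightarrow> t"
proof (rule tendsto_sandwich[of "\<lambda>m. t - 1 / real (Suc m)" _ _ "\<lambda>_. t"])
  have "(\<lambda>m. t - 1 / real (Suc m)) \<longlonglongrightarrow> t - 0"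
    by (intro tendsto_intros LIMSEQ_inverse_real_of_nat[unfolded inverse_eq_divide])
  then show "(\<lambda>m. t - 1 / real (Suc m)) \<longlonglongrightarrow> t" by simp
qed (auto intro!: always_eventually grid_ge less_imp_le[OF grid_less] simp del: of_nat_Suc)

lemma grid_cell:
  assumes "0 < t"
  obtains j :: nat where "grid m t = real j / real (Suc m)"
    "t \<in> {real j / real (Suc m)<..real (Suc j) / real (Suc m)}"
proof -
  let ?j = "nat (\<lceil>t * real (Suc m)\<rceil> - 1)"
  have "0 < t * real (Suc m)" using assms by simp
  then have "real ?j = of_int \<lceil>t * real (Suc m)\<rceil> - 1" by (simp del: of_nat_Suc)
  then have g: "grid m t = real ?j / real (Suc m)" by (simp add: grid_def del: of_nat_Suc)
  have "t \<le> grid m t + 1 / real (Suc m)" using grid_ge[of t m] by simp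
  also have "\<dots> = real (Suc ?j) / real (Suc m)" unfolding g by (simp add: add_divide_distrib)
  finally show thesis using that[OF g] grid_less[of m t] g by simp
qed

lemma grid_eqI:
  assumes "t \<in> {real j / real (Suc m)<..real (Suc j) / real (Suc m)}"
  shows "grid m t = real j / real (Suc m)"
proof -
  have "real j < t * real (Suc m)" "t * real (Suc m) \<le> real (Suc j)"
    using assms by (simp_all add: pos_divide_less_eq pos_le_divide_eq del: of_nat_Suc)
  then have "\<lceil>t * real (Suc m)\<rceil> = int j + 1" by (intro ceiling_unique) auto
  then show ?thesis by (simp add: grid_def)
qed

lemma space_history [simp]: "space (history M T t) = space M"
  unfolding history_def by (rule space_measure_of_conv)

lemma space_predictable [simp]: "space (predictable M T) = {0<..} \<times> space M"
  unfolding predictable_def by (rule space_measure_of_conv)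

lemma predictable_rectangle:
  assumes "0 \<le> s" "s \<le> u" "A \<in> sets (history M T s)"
  shows "{s<..u} \<times> A \<in> sets (predictable M T)"
proof -
  have "{{s<..u} \<times> A | s u A. 0 \<le> s \<and> s \<le> u \<and> A \<in> sets (history M T s)}
      \<subseteq> Pow ({0<..} \<times> space M)"
    using sets.sets_into_space[of _ "history M T _"] by fastforce
  then show ?thesis unfolding predictable_def
    using assms by (auto simp: sets_measure_of intro!: sigma_sets.Basic)
qed

text \<open>
  On the cell \<open>(j / (m + 1), (j + 1) / (m + 1)]\<close> the sampled process is the value at the left end of
  the cell, which the history at that end already determines.  Preimages are therefore countable
  unions of the generating rectangles of the predictable \<open>\<sigma>\<close>-algebra.
\<close>
lemma grid_sampled_predictable:
  assumes "\<And>s. 0 \<le> s \<Longrightarrow> X s \<in> borel_measurable (history M T s)"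
  shows "(\<lambda>(t, \<omega>). X (grid m t) \<omega>) \<in> borel_measurable (predictable M T)"
proof (rule measurableI)
  fix B :: "'b set" assume B: "B \<in> sets borel"
  let ?q = "\<lambda>j. real j / real (Suc m)"
  have "(\<lambda>(t, \<omega>). X (grid m t) \<omega>) -` B \<inter> space (predictable M T) =
      (\<Union>j::nat. {?q j<..?q (Suc j)} \<times> (X (?q j) -` B \<inter> space M))" (is "?L = ?R")
  proof (intro set_eqI iffI)
    fix p assume "p \<in> ?L"
    then obtain t \<omega> where p: "p = (t, \<omega>)" "0 < t" "\<omega> \<in> space M" "X (grid m t) \<omega> \<in> B" by auto
    from grid_cell[OF p(2), of m] obtain j where
      "grid m t = ?q j" "t \<in> {?q j<..?q (Suc j)}" .
    with p show "p \<in> ?R" by auto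
  next
    fix p assume "p \<in> ?R"
    then obtain j t \<omega> where p: "p = (t, \<omega>)" "t \<in> {?q j<..?q (Suc j)}"
      "\<omega> \<in> space M" "X (?q j) \<omega> \<in> B" by blast
    have "0 \<le> ?q j" by simp
    then have "0 < t" using p(2) by (simp only: greaterThanAtMost_iff) linarith
    then show "p \<in> ?L" using p grid_eqI[OF p(2)] by simp
  qed
  moreover have "{?q j<..?q (Suc j)} \<times> (X (?q j) -` B \<inter> space M) \<in> sets (predictable M T)" for j
    using measurable_sets[OF assms[of "?q j"] B]
    by (intro predictable_rectangle) (auto intro!: divide_right_mono)
  ultimately show "(\<lambda>(t, \<omega>). X (grid m t) \<omega>) -` B \<inter> space (predictable M T)
      \<in> sets (predictable M T)" by auto
qed auto

text \<open>
  Adaptedness is the section at time \<open>s\<close> of progressive measurability on \<open>[0, s]\<close>.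
\<close>
lemma conditional_intensity_adapted:
  assumes "conditional_intensity M T l" "0 \<le> s"
  shows "l s \<in> borel_measurable (history M T s)"
proof -
  have "(\<lambda>(s, \<omega>). l s \<omega>)
      \<in> borel_measurable (restrict_space borel {0..s} \<Otimes>\<^sub>M history M T s)"
    using assms by (auto simp: conditional_intensity_def)
  from measurable_compose[OF measurable_Pair1' this, of s] show ?thesis
    using assms(2) by (simp add: space_restrict_space)
qed

lemma conditional_intensity_nn_integral:
  assumes "conditional_intensity M T l" "C \<in> borel_measurable (predictable M T)"
  shows "(\<integral>\<^sup>+\<omega>. (\<Sum>k. C (T (Suc k) \<omega>, \<omega>)) \<partial>M) =
      (\<integral>\<^sup>+\<omega>. (\<integral>\<^sup>+u\<in>{0<..}. (C (u, \<omega>) * ennreal (l u \<omega>)) \<partial>lborel) \<partial>M)"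
  using assms(1)[unfolded conditional_intensity_def, THEN conjunct2, THEN conjunct2, THEN conjunct2]
    assms(2) by (rule bspec)

context event_path
begin

lemma branch_isCont:
  assumes h: "continuous_on {0<..} h" and t: "T n \<omega> < t"
  shows "isCont (\<lambda>t. branch l h T n t \<omega>) t"
proof -
  have "isCont (\<lambda>t. h (t - T k \<omega>)) t" if "k \<in> {1..n}" for k
  proof -
    have "0 < t - T k \<omega>" using that t le_iff[of k n] by simp
    then have "isCont h (t - T k \<omega>)"
      using h continuous_on_eq_continuous_at[of "{0<..}" h] by simp
    moreover have "isCont (\<lambda>t. t - T k \<omega>) t" by simp
    ultimately show ?thesis by (rule isCont_o2[rotated])
  qed
  then show ?thesis unfolding branch_def by (intro continuous_intros) auto
qed

text \<open>
  Eventually the grid points lie in \<open>(T\<^sub>n, t)\<close>, where the intensity is the positive part of the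
  continuous branch.  The embedding \<open>ennreal\<close> already truncates negative values to zero, so the
  positive part disappears in the conclusion.
\<close>
lemma liminf_grid_intensity:
  assumes h: "continuous_on {0<..} h" and t: "T n \<omega> < t" "t \<le> T (Suc n) \<omega>"
  shows "liminf (\<lambda>m. ennreal (intensity l h T (grid m t) \<omega>)) = ennreal (branch l h T n t \<omega>)"
proof -
  have "(\<lambda>m. branch l h T n (grid m t) \<omega>) \<longlonglongrightarrow> branch l h T n t \<omega>"
    using isCont_tendsto_compose[OF branch_isCont[OF h t(1)] grid_tendsto] .
  then have "(\<lambda>m. ennreal (branch l h T n (grid m t) \<omega>)) \<longlonglongrightarrow> ennreal (branch l h T n t \<omega>)"
    by (rule tendsto_ennrealI)
  moreover have "\<forall>\<^sub>F m in sequentially. T n \<omega> < grid m t"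
    using order_tendstoD(1)[OF grid_tendsto t(1)] .
  then have "\<forall>\<^sub>F m in sequentially.
      ennreal (branch l h T n (grid m t) \<omega>) = ennreal (intensity l h T (grid m t) \<omega>)"
  proof eventually_elim
    case (elim m)
    then have "intensity l h T (grid m t) \<omega> = max 0 (branch l h T n (grid m t) \<omega>)"
      using grid_less[of m t] t by (intro intensity_between) auto
    then show ?case by (auto simp: max_def ennreal_neg)
  qed
  ultimately have "(\<lambda>m. ennreal (intensity l h T (grid m t) \<omega>)) \<longlonglongrightarrow> ennreal (branch l h T n t \<omega>)"
    by (rule Lim_transform_eventually)
  then show ?thesis by (intro lim_imp_Liminf) auto
qed

end

lemma (in simple_point_process) event_path_of_outcome: "\<omega> \<in> space M \<Longrightarrow> event_path T \<omega>"
  using T_0 T_strict_mono T_locally_finite by unfold_locales auto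

section \<open>Positive intensity just before every event\<close>

text \<open>
  The conditional intensity identity, applied to the predictable indicator of a vanishing left limit,
  equates the expected number of events in that set with an integral of the intensity over
  times where, up to a Lebesgue null set, the intensity is zero.
\<close>
lemma (in hawkes_process) AE_intensity_pos_before_event:
  assumes h: "continuous_on {0<..} h"
  shows "AE \<omega> in M. \<forall>n. 0 < branch lambda0 h T n (T (Suc n) \<omega>) \<omega>"
proof -
  define Z where "Z = (\<lambda>(t, \<omega>). liminf (\<lambda>m. ennreal (intensity lambda0 h T (grid m t) \<omega>)))"
  let ?C = "\<lambda>p. if Z p = 0 then 1 else 0 :: ennreal"
  let ?b = "\<lambda>n \<omega>. branch lambda0 h T n (T (Suc n) \<omega>) \<omega>"
  have Z_eq: "Z (t, \<omega>) = ennreal (branch lambda0 h T n t \<omega>)"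
    if "\<omega> \<in> space M" "T n \<omega> < t" "t \<le> T (Suc n) \<omega>" for n t \<omega>
    using event_path.liminf_grid_intensity[OF event_path_of_outcome[OF that(1)] h that(2,3)]
    by (simp add: Z_def)
  have "(\<lambda>(t, \<omega>). intensity lambda0 h T (grid m t) \<omega>) \<in> borel_measurable (predictable M T)" for m
    by (intro grid_sampled_predictable conditional_intensity_adapted intensity)
  then have "(\<lambda>p. liminf (\<lambda>m. ennreal ((\<lambda>(t, \<omega>). intensity lambda0 h T (grid m t) \<omega>) p)))
      \<in> borel_measurable (predictable M T)"
    by (intro borel_measurable_liminf measurable_compose[OF _ measurable_ennreal])
  then have "Z \<in> borel_measurable (predictable M T)"
    by (simp add: Z_def case_prod_beta')
  moreover have "(\<lambda>z::ennreal. if z = 0 then 1 else 0 :: ennreal) \<in> borel_measurable borel"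
    by measurable
  ultimately have "?C \<in> borel_measurable (predictable M T)"
    by (rule measurable_compose)
  then have eq: "(\<integral>\<^sup>+\<omega>. (\<Sum>k. ?C (T (Suc k) \<omega>, \<omega>)) \<partial>M) =
      (\<integral>\<^sup>+\<omega>. (\<integral>\<^sup>+u\<in>{0<..}. (?C (u, \<omega>) * ennreal (intensity lambda0 h T u \<omega>)) \<partial>lborel) \<partial>M)"
    by (rule conditional_intensity_nn_integral[OF intensity])
  have "(\<integral>\<^sup>+u\<in>{0<..}. (?C (u, \<omega>) * ennreal (intensity lambda0 h T u \<omega>)) \<partial>lborel) = 0"
    if "\<omega> \<in> space M" for \<omega>
  proof -
    interpret event_path T \<omega> using event_path_of_outcome[OF that] .
    \<comment> \<open>Off the event times the intensity agrees with its left limit, so one of the two factors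
      vanishes.\<close>
    have "range (\<lambda>k. T k \<omega>) \<in> null_sets lborel"
      by (intro countable_imp_null_set_lborel) auto
    then have "AE u in lborel. u \<notin> range (\<lambda>k. T k \<omega>)" by (rule AE_not_in)
    then have "AE u in lborel. ?C (u, \<omega>) * ennreal (intensity lambda0 h T u \<omega>)
        * indicator {0<..} u = 0"
    proof eventually_elim
      case (elim u)
      show ?case
      proof (cases "0 < u")
        case True
        then obtain n where n: "T n \<omega> < u" "u \<le> T (Suc n) \<omega>" by (rule last_event_before_exists)
        then have "u < T (Suc n) \<omega>" using elim by (metis order_le_less rangeI)
        then have "intensity lambda0 h T u \<omega> = max 0 (branch lambda0 h T n u \<omega>)"
          using n by (intro intensity_between) auto
        then show ?thesis using Z_eq[OF that n]
          by (auto simp: max_def ennreal_eq_0_iff)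
      qed simp
    qed
    then have "(\<integral>\<^sup>+u\<in>{0<..}. (?C (u, \<omega>) * ennreal (intensity lambda0 h T u \<omega>)) \<partial>lborel)
        = (\<integral>\<^sup>+(u::real). 0 \<partial>lborel)"
      by (rule nn_integral_cong_AE)
    then show ?thesis by simp
  qed
  then have "(\<integral>\<^sup>+\<omega>. (\<integral>\<^sup>+u\<in>{0<..}. (?C (u, \<omega>) * ennreal (intensity lambda0 h T u \<omega>)) \<partial>lborel) \<partial>M) = 0"
    by (simp cong: nn_integral_cong)
  moreover have "(\<integral>\<^sup>+\<omega>. (\<Sum>k. ?C (T (Suc k) \<omega>, \<omega>)) \<partial>M) =
      (\<integral>\<^sup>+\<omega>. (\<Sum>k. if ?b k \<omega> \<le> 0 then 1 else 0) \<partial>M)"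
  proof (rule nn_integral_cong)
    fix \<omega> assume \<omega>: "\<omega> \<in> space M"
    then interpret event_path T \<omega> by (rule event_path_of_outcome)
    have "?C (T (Suc k) \<omega>, \<omega>) = (if ?b k \<omega> \<le> 0 then 1 else 0)" for k
      using Z_eq[OF \<omega>, of k "T (Suc k) \<omega>"]
      by (simp add: less_iff ennreal_eq_0_iff)
    then show "(\<Sum>k. ?C (T (Suc k) \<omega>, \<omega>)) = (\<Sum>k. if ?b k \<omega> \<le> 0 then 1 else 0)" by simp
  qed
  ultimately have int0: "(\<integral>\<^sup>+\<omega>. (\<Sum>k. if ?b k \<omega> \<le> 0 then 1 else 0 :: ennreal) \<partial>M) = 0"
    using eq by simp
  have b_measurable [measurable]: "?b n \<in> borel_measurable M" for n
  proof -
    \<comment> \<open>Continuity of the kernel is assumed on \<open>(0, \<infinity>)\<close> only; cutting it off at \<open>0\<close> makes it Borel on the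
      whole line, and only positive lags occur.\<close>
    let ?g = "\<lambda>x. indicator {0<..} x *\<^sub>R h x"
    have g [measurable]: "?g \<in> borel_measurable borel"
      using h by (intro borel_measurable_continuous_on_indicator) auto
    have [measurable]: "T k \<in> borel_measurable M" for k by (rule T_measurable)
    have "(\<lambda>\<omega>. lambda0 + (\<Sum>k\<in>{1..n}. ?g (T (Suc n) \<omega> - T k \<omega>))) \<in> borel_measurable M"
      by (intro borel_measurable_add borel_measurable_sum borel_measurable_const
          measurable_compose[OF _ g]) measurable
    also have "?this \<longleftrightarrow> ?thesis"
    proof (rule measurable_cong)
      fix \<omega> assume "\<omega> \<in> space M"
      then interpret event_path T \<omega> by (rule event_path_of_outcome)
      show "lambda0 + (\<Sum>k\<in>{1..n}. ?g (T (Suc n) \<omega> - T k \<omega>)) = ?b n \<omega>"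
        unfolding branch_def using less_iff by (auto intro!: sum.cong)
    qed
    finally show ?thesis .
  qed
  have "AE \<omega> in M. (\<Sum>k. if ?b k \<omega> \<le> 0 then 1 else 0 :: ennreal) = 0"
    using int0 by (subst (asm) nn_integral_0_iff_AE) measurable
  then show ?thesis
  proof eventually_elim
    case (elim \<omega>)
    then have "\<forall>k. (if ?b k \<omega> \<le> 0 then 1 else 0 :: ennreal) = 0"
      using suminf_eq_zero_iff[of "\<lambda>k. if ?b k \<omega> \<le> 0 then 1 else 0 :: ennreal"] by auto
    then show ?case by (metis not_le zero_neq_one)
  qed
qed

section \<open>Relaxation of the exponential branch\<close>

text \<open>
  Here \<open>a\<close> is the starting value, \<open>l\<close> the limit and \<open>b\<close> the rate.  For \<open>a < 0\<close> the function vanishes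
  where \<open>exp (b x) = (l - a) / l\<close>, and its sign is decided by
  comparing \<open>exp (b x)\<close> with this ratio.
\<close>
lemma relaxation_at_most_zero_before:
  fixes l a b x :: real
  assumes "0 < l" "0 < b" "a < 0" "x \<le> 1 / b * ln ((l - a) / l)"
  shows "l + (a - l) * exp (- b * x) \<le> 0"
proof -
  have "b * x \<le> ln ((l - a) / l)" using assms by (simp add: field_simps)
  then have "exp (b * x) \<le> (l - a) / l"
    using assms by (subst (asm) ln_ge_iff) auto
  then have "l * exp (b * x) \<le> l - a" using assms by (simp add: field_simps)
  then have "l * exp (b * x) * exp (- b * x) \<le> (l - a) * exp (- b * x)"
    by (intro mult_right_mono) auto
  moreover have "exp (b * x) * exp (- b * x) = 1" by (simp flip: exp_add)
  ultimately show ?thesis by (simp add: mult.assoc left_diff_distrib)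
qed

text \<open>
  For \<open>a \<ge> 0\<close> the value is a combination of \<open>l > 0\<close> and \<open>a\<close> in which \<open>l\<close> has positive weight as soon
  as \<open>x > 0\<close>; this covers \<open>a = 0\<close>, where the function vanishes at the start only.
\<close>
lemma relaxation_pos_after:
  fixes l a b x :: real
  assumes "0 < l" "0 < b" "0 \<le> x" "(if a < 0 then 1 / b * ln ((l - a) / l) else 0) < x"
  shows "0 < l + (a - l) * exp (- b * x)"
proof (cases "a < 0")
  case True
  then have "ln ((l - a) / l) < b * x" using assms by (simp add: field_simps)
  then have "(l - a) / l < exp (b * x)"
    using assms True by (metis diff_gt_0_iff_gt divide_pos_pos exp_less_mono exp_ln less_trans)
  then have "l - a < l * exp (b * x)" using assms by (simp add: field_simps)
  then have "(l - a) * exp (- b * x) < l * exp (b * x) * exp (- b * x)"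
    by (intro mult_strict_right_mono) auto
  moreover have "exp (b * x) * exp (- b * x) = 1" by (simp flip: exp_add)
  ultimately show ?thesis by (simp add: mult.assoc left_diff_distrib)
next
  case False
  then have "exp (- b * x) < 1" using assms by simp
  then have "0 < l * (1 - exp (- b * x))" using assms by simp
  moreover have "0 \<le> a * exp (- b * x)" using False by simp
  ultimately show ?thesis by (simp add: algebra_simps)
qed

lemma LBINT_relaxation:
  fixes l a b c p q :: real
  assumes "0 < b" "p \<le> q"
  shows "(LBINT u=p..q. l + (a - l) * exp (- b * (u - c))) =
    l * (q - p) + 1 / b * (a - l) * (exp (- b * (p - c)) - exp (- b * (q - c)))"
proof -
  let ?F = "\<lambda>u. l * u - 1 / b * (a - l) * exp (- b * (u - c))"
  have "(LBINT u=p..q. l + (a - l) * exp (- b * (u - c))) = ?F q - ?F p"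
    using assms by (intro interval_integral_FTC_finite)
      (auto intro!: continuous_intros derivative_eq_intros
        simp flip: has_real_derivative_iff_has_vector_derivative)
  then show ?thesis by (simp add: algebra_simps)
qed

section \<open>Restart times and compensator along a path\<close>

text \<open>
  The last two assumptions collect what holds almost surely: positive left limits at the events, and
  local integrability of the intensity.
\<close>
locale exponential_path = event_path T \<omega>
  for T :: "nat \<Rightarrow> 'w \<Rightarrow> real" and \<omega> :: 'w +
  fixes lambda0 \<alpha> \<beta> :: real and h :: "real \<Rightarrow> real"
  defines "h \<equiv> (\<lambda>t. \<alpha> * exp (- \<beta> * t))"
  assumes lambda0_pos: "0 < lambda0" and \<beta>_pos: "0 < \<beta>"
    and pos_before_event: "\<And>n. 0 < branch lambda0 h T n (T (Suc n) \<omega>) \<omega>"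
    and integrable: "\<And>t. 0 \<le> t \<Longrightarrow> set_integrable lborel {0..t} (\<lambda>u. intensity lambda0 h T u \<omega>)"
begin

abbreviation "lamstar t \<equiv> underlying_intensity lambda0 h T t \<omega>"
abbreviation "lam t \<equiv> intensity lambda0 h T t \<omega>"
abbreviation "Tstar n \<equiv> restart_time lambda0 h T n \<omega>"

text \<open>
  The exponential kernel is multiplicative, so the contributions of all past events decay by the same
  factor and the value at \<open>T\<^sub>n\<close> alone determines the branch.
\<close>
lemma branch_relaxation:
  "branch lambda0 h T n t \<omega> = lambda0 + (lamstar (T n \<omega>) - lambda0) * exp (- \<beta> * (t - T n \<omega>))"
proof -
  have "h (t - T k \<omega>) = h (T n \<omega> - T k \<omega>) * exp (- \<beta> * (t - T n \<omega>))" for k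
    unfolding h_def by (simp add: algebra_simps flip: exp_add)
  then have "branch lambda0 h T n t \<omega>
      = lambda0 + (branch lambda0 h T n (T n \<omega>) \<omega> - lambda0) * exp (- \<beta> * (t - T n \<omega>))"
    unfolding branch_def by (simp add: sum_distrib_right)
  then show ?thesis by (simp add: underlying_between[of n] less_iff)
qed

definition zero_crossing :: "nat \<Rightarrow> real" where
  "zero_crossing n = T n \<omega> +
    (if lamstar (T n \<omega>) < 0 then 1 / \<beta> * ln ((lambda0 - lamstar (T n \<omega>)) / lambda0) else 0)"

lemma zero_crossing_ge: "T n \<omega> \<le> zero_crossing n"
  using lambda0_pos \<beta>_pos by (auto simp: zero_crossing_def)

lemma branch_pos_after_crossing:
  assumes "zero_crossing n < t"
  shows "0 < branch lambda0 h T n t \<omega>"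
proof -
  have "T n \<omega> < t" using assms zero_crossing_ge[of n] by simp
  then show ?thesis unfolding branch_relaxation
    using assms lambda0_pos \<beta>_pos
    by (intro relaxation_pos_after) (auto simp: zero_crossing_def)
qed

lemma branch_nonpos_before_crossing:
  assumes "T n \<omega> \<le> t" "t < zero_crossing n"
  shows "branch lambda0 h T n t \<omega> \<le> 0"
proof -
  have "lamstar (T n \<omega>) < 0" using assms by (auto simp: zero_crossing_def split: if_splits)
  then show ?thesis unfolding branch_relaxation
    using assms lambda0_pos \<beta>_pos
    by (intro relaxation_at_most_zero_before) (auto simp: zero_crossing_def)
qed

text \<open>
  A crossing at or after the next event would leave a nonpositive left limit at that event.
\<close>
lemma zero_crossing_less: "zero_crossing n < T (Suc n) \<omega>"
proof (rule ccontr)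
  assume *: "\<not> zero_crossing n < T (Suc n) \<omega>"
  have less: "T n \<omega> < T (Suc n) \<omega>" by (simp add: less_iff)
  with * have "lamstar (T n \<omega>) < 0" by (auto simp: zero_crossing_def split: if_splits)
  then have "branch lambda0 h T n (T (Suc n) \<omega>) \<omega> \<le> 0" unfolding branch_relaxation
    using * lambda0_pos \<beta>_pos
    by (intro relaxation_at_most_zero_before) (auto simp: zero_crossing_def)
  with pos_before_event[of n] show False by simp
qed

lemma lam_zero_before_crossing:
  assumes "T n \<omega> \<le> t" "t < zero_crossing n"
  shows "lam t = 0"
  using intensity_between[of n t] branch_nonpos_before_crossing[OF assms] assms
    zero_crossing_less[of n] by simp

lemma lam_pos_after_crossing:
  assumes "zero_crossing n < t" "t < T (Suc n) \<omega>"
  shows "lam t = lamstar t" "0 < lam t"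
  using intensity_between[of n t] underlying_between[of n t] branch_pos_after_crossing[OF assms(1)]
    assms zero_crossing_ge[of n] by simp_all

text \<open>
  The intensity vanishes from \<open>T\<^sub>n\<close> up to the crossing, and it is positive on the nonempty interval
  from the crossing to the next event.  The infimum is therefore decided before the next event, and
  later jumps have no influence on it.
\<close>
lemma restart_time_eq: "Tstar n = zero_crossing n"
proof -
  let ?S = "{t. T n \<omega> \<le> t \<and> 0 < lam t}"
  have mem: "t \<in> ?S" if "zero_crossing n < t" "t < T (Suc n) \<omega>" for t
    using lam_pos_after_crossing[OF that] zero_crossing_ge[of n] that by simp
  have lower: "zero_crossing n \<le> t" if "t \<in> ?S" for t
    using lam_zero_before_crossing[of n t] that by (auto simp: not_le[symmetric])
  have "Inf ?S = zero_crossing n"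
  proof (rule cInf_eq_non_empty)
    show "?S \<noteq> {}" using mem dense[OF zero_crossing_less[of n]] by blast
    show "zero_crossing n \<le> t" if "t \<in> ?S" for t using lower[OF that] .
    show "y \<le> zero_crossing n" if y: "\<And>t. t \<in> ?S \<Longrightarrow> y \<le> t" for y
    proof (rule dense_ge_bounded[OF zero_crossing_less[of n]])
      show "y \<le> t" if "zero_crossing n < t" "t < T (Suc n) \<omega>" for t
        using y mem that by simp
    qed
  qed
  then show ?thesis unfolding restart_time_def .
qed

lemma restart_time_bounds: "T n \<omega> \<le> Tstar n" "Tstar n < T (Suc n) \<omega>"
  using zero_crossing_ge zero_crossing_less by (simp_all add: restart_time_eq)

lemma LBINT_lamstar_after_restart:
  assumes "Tstar n \<le> \<tau>" "\<tau> \<le> T (Suc n) \<omega>"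
  shows "(LBINT u=Tstar n..\<tau>. lamstar u) =
    lambda0 * (\<tau> - Tstar n) + 1 / \<beta> * (lamstar (T n \<omega>) - lambda0) *
      (exp (- \<beta> * (Tstar n - T n \<omega>)) - exp (- \<beta> * (\<tau> - T n \<omega>)))"
proof -
  have "(LBINT u=Tstar n..\<tau>. lamstar u) =
      (LBINT u=Tstar n..\<tau>. lambda0 + (lamstar (T n \<omega>) - lambda0) * exp (- \<beta> * (u - T n \<omega>)))"
    using assms restart_time_bounds(1)[of n] unfolding branch_relaxation[symmetric]
    by (intro interval_integral_cong) (auto simp: einterval_def min_def underlying_between)
  then show ?thesis using LBINT_relaxation[OF \<beta>_pos assms(1)] by simp
qed

lemma interval_integrable_lam:
  assumes "0 \<le> a" "a \<le> b"
  shows "interval_lebesgue_integrable lborel (ereal a) (ereal b) lam"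
  unfolding interval_lebesgue_integrable_def using assms
  by (auto intro!: set_integrable_subset[OF integrable[of b]] simp: einterval_def)

lemma LBINT_lam_add:
  fixes a b c :: real
  assumes "0 \<le> a" "a \<le> b" "b \<le> c"
  shows "(LBINT u=a..c. lam u) = (LBINT u=a..b. lam u) + (LBINT u=b..c. lam u)"
  using assms interval_integrable_lam[of a c]
  by (intro interval_integral_sum[symmetric]) (simp add: min_def max_def)

text \<open>
  The intensity vanishes up to the restart time; afterwards it agrees with the underlying intensity.
\<close>
lemma LBINT_lam_from_event:
  assumes "T n \<omega> \<le> t" "t \<le> T (Suc n) \<omega>"
  shows "(LBINT u=T n \<omega>..t. lam u) = (if t < Tstar n then 0 else LBINT u=Tstar n..t. lamstar u)"
proof -
  have silent: "(LBINT u=T n \<omega>..s. lam u) = 0" if "T n \<omega> \<le> s" "s \<le> Tstar n" for s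
  proof -
    have "(LBINT u=T n \<omega>..s. lam u) = (LBINT u=T n \<omega>..s. 0)"
      using that by (intro interval_integral_cong lam_zero_before_crossing[of n])
        (auto simp: einterval_def min_def max_def restart_time_eq)
    then show ?thesis by simp
  qed
  show ?thesis
  proof (cases "t < Tstar n")
    case True
    then show ?thesis using silent[of t] assms by simp
  next
    case False
    then have "(LBINT u=T n \<omega>..t. lam u)
        = (LBINT u=T n \<omega>..Tstar n. lam u) + (LBINT u=Tstar n..t. lam u)"
      using restart_time_bounds[of n] event_nonneg[of n] by (intro LBINT_lam_add) auto
    moreover have "(LBINT u=Tstar n..t. lam u) = (LBINT u=Tstar n..t. lamstar u)"
      using False assms by (intro interval_integral_cong)
        (auto simp: einterval_def min_def max_def restart_time_eq lam_pos_after_crossing)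
    ultimately show ?thesis using False silent[of "Tstar n"] restart_time_bounds[of n] by simp
  qed
qed

lemma compensator_before_first:
  assumes "0 \<le> t" "t \<le> T 1 \<omega>"
  shows "compensator lambda0 h T t \<omega> = lambda0 * t"
proof -
  have "lam u = lambda0" if "0 < u" "u < t" for u
    using intensity_between[of 0 u] that assms start lambda0_pos by (simp add: branch_def)
  then have "compensator lambda0 h T t \<omega> = (LBINT u=0..t. lambda0)"
    unfolding compensator_def using assms
    by (intro interval_integral_cong) (auto simp: einterval_def min_def max_def zero_ereal_def)
  then show ?thesis using assms interval_integral_const[of 0 t lambda0] by (simp add: zero_ereal_def)
qed

lemma compensator_at_event:
  "compensator lambda0 h T (T (Suc n) \<omega>) \<omega> =
    lambda0 * T 1 \<omega> + (\<Sum>j = 1..n. LBINT u=Tstar j..T (j + 1) \<omega>. lamstar u)"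
proof (induction n)
  case 0
  show ?case using compensator_before_first[of "T 1 \<omega>"] event_nonneg by simp
next
  case (Suc n)
  have "compensator lambda0 h T (T (Suc (Suc n)) \<omega>) \<omega> = compensator lambda0 h T (T (Suc n) \<omega>) \<omega>
      + (LBINT u=T (Suc n) \<omega>..T (Suc (Suc n)) \<omega>. lam u)"
    unfolding compensator_def zero_ereal_def
    using event_nonneg le_iff by (intro LBINT_lam_add) auto
  also have "(LBINT u=T (Suc n) \<omega>..T (Suc (Suc n)) \<omega>. lam u)
      = (LBINT u=Tstar (Suc n)..T (Suc (Suc n)) \<omega>. lamstar u)"
    using LBINT_lam_from_event[of "Suc n" "T (Suc (Suc n)) \<omega>"] restart_time_bounds[of "Suc n"]
    by (simp add: le_iff)
  finally show ?case using Suc by simp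
qed

lemma compensator_eq:
  assumes "T (Suc n) \<omega> \<le> t" "t < T (Suc (Suc n)) \<omega>"
  shows "compensator lambda0 h T t \<omega> =
    lambda0 * T 1 \<omega> + (\<Sum>j = 1..n. LBINT u=Tstar j..T (j + 1) \<omega>. lamstar u) +
      (if t < Tstar (Suc n) then 0 else LBINT u=Tstar (Suc n)..t. lamstar u)"
proof -
  have "compensator lambda0 h T t \<omega>
      = compensator lambda0 h T (T (Suc n) \<omega>) \<omega> + (LBINT u=T (Suc n) \<omega>..t. lam u)"
    unfolding compensator_def zero_ereal_def
    using event_nonneg assms by (intro LBINT_lam_add) auto
  then show ?thesis
    using LBINT_lam_from_event[of "Suc n" t] assms by (simp add: compensator_at_event)
qed

end

theorem proposition3p2:
  fixes M :: "'w measure" and T :: "nat \<Rightarrow> 'w \<Rightarrow> real"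
    and lambda0 \<alpha> \<beta> :: real
  defines "h \<equiv> (\<lambda>t::real. \<alpha> * exp (- \<beta> * t))"
  defines "N \<equiv> counting T"
    and "lamstar \<equiv> underlying_intensity lambda0 h T"
    and "Tstar \<equiv> restart_time lambda0 h T"
    and "\<Lambda> \<equiv> compensator lambda0 h T"
  assumes "0 < lambda0" and "0 < \<beta>"
    and "hawkes_process M T lambda0 h"
  shows "AE \<omega> in M. \<forall>t>0.
    (\<forall>k\<in>{1..N t \<omega>}.
       Tstar k \<omega> = T k \<omega> +
         (if lamstar (T k \<omega>) \<omega> < 0
          then 1 / \<beta> * ln ((lambda0 - lamstar (T k \<omega>) \<omega>) / lambda0) else 0) \<and>
       (\<forall>\<tau>\<in>{Tstar k \<omega>..T (k + 1) \<omega>}.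
          (LBINT u=Tstar k \<omega>..\<tau>. lamstar u \<omega>) =
            lambda0 * (\<tau> - Tstar k \<omega>) +
            1 / \<beta> * (lamstar (T k \<omega>) \<omega> - lambda0) *
              (exp (- \<beta> * (Tstar k \<omega> - T k \<omega>)) - exp (- \<beta> * (\<tau> - T k \<omega>))))) \<and>
    \<Lambda> t \<omega> =
      (if t < T 1 \<omega> then lambda0 * t
       else lambda0 * T 1 \<omega> +
         (\<Sum>j = 1..N t \<omega> - 1. LBINT u=Tstar j \<omega>..T (j + 1) \<omega>. lamstar u \<omega>) +
         (if t < Tstar (N t \<omega>) \<omega> then 0
          else LBINT u=Tstar (N t \<omega>) \<omega>..t. lamstar u \<omega>))"
proof -
  interpret hawkes_process M T lambda0 h by fact
  have "continuous_on {0<..} h" unfolding h_def by (intro continuous_intros)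
  then have "AE \<omega> in M. \<forall>n. 0 < branch lambda0 h T n (T (Suc n) \<omega>) \<omega>"
    by (rule AE_intensity_pos_before_event)
  moreover have "AE \<omega> in M. \<forall>t\<ge>0. set_integrable lborel {0..t} (\<lambda>u. intensity lambda0 h T u \<omega>)"
    using intensity by (simp add: conditional_intensity_def)
  ultimately show ?thesis using AE_space
  proof eventually_elim
    case (elim \<omega>)
    interpret event_path T \<omega> using elim by (intro event_path_of_outcome)
    interpret exponential_path T \<omega> lambda0 \<alpha> \<beta> h
      using elim assms(6,7) by unfold_locales (simp_all add: h_def)
    show ?case
    proof (intro allI impI conjI ballI)
      fix k
      show "Tstar k \<omega> = T k \<omega> + (if lamstar (T k \<omega>) \<omega> < 0
          then 1 / \<beta> * ln ((lambda0 - lamstar (T k \<omega>) \<omega>) / lambda0) else 0)"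
        unfolding Tstar_def lamstar_def restart_time_eq zero_crossing_def ..
      fix \<tau> assume "\<tau> \<in> {Tstar k \<omega>..T (k + 1) \<omega>}"
      then show "(LBINT u=Tstar k \<omega>..\<tau>. lamstar u \<omega>) =
            lambda0 * (\<tau> - Tstar k \<omega>) +
            1 / \<beta> * (lamstar (T k \<omega>) \<omega> - lambda0) *
              (exp (- \<beta> * (Tstar k \<omega> - T k \<omega>)) - exp (- \<beta> * (\<tau> - T k \<omega>)))"
        unfolding Tstar_def lamstar_def by (intro LBINT_lamstar_after_restart) auto
    next
      fix t :: real assume "0 < t"
      then obtain n where n: "T n \<omega> \<le> t" "t < T (Suc n) \<omega>"
        using last_event_exists[of t] by auto
      show "\<Lambda> t \<omega> = (if t < T 1 \<omega> then lambda0 * t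
         else lambda0 * T 1 \<omega> +
           (\<Sum>j = 1..N t \<omega> - 1. LBINT u=Tstar j \<omega>..T (j + 1) \<omega>. lamstar u \<omega>) +
           (if t < Tstar (N t \<omega>) \<omega> then 0
            else LBINT u=Tstar (N t \<omega>) \<omega>..t. lamstar u \<omega>))"
      proof (cases n)
        case 0
        then show ?thesis using n \<open>0 < t\<close> compensator_before_first[of t] by (simp add: \<Lambda>_def)
      next
        case (Suc m)
        then have "\<not> t < T 1 \<omega>" using event_le_iff[OF n, of 1] by simp
        then show ?thesis using compensator_eq[of m t] n Suc
          by (simp add: \<Lambda>_def N_def Tstar_def lamstar_def counting_between[OF n])
      qed
    qed
  qed
qed

end
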